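(* Let $k,\ell\ge 1$ be integers. Then there is no perfect state transfer on the double star graph $S_{k,\ell}$; that is, there are no two distinct vertices $a,b$ of $S_{k,\ell}$, real number $\tau$ and complex number $\gamma$ such that $\exp(i\tau A)e_a=\gamma e_b$, where $A$ is the adjacency matrix of $S_{k,\ell}$.
   Context: Graphs are finite, simple and undirected. For a star with $k$ edges (a central vertex adjacent to $k$ leaves) and a star with $\ell$ edges, the double star graph $S_{k,\ell}$ is the graph obtained by joining the two centers (of degrees $k$ and $\ell$) by a new edge; thus the two central vertices are adjacent, have degrees $k+1$ and $\ell+1$, and all other vertices have degree one. For a vertex $a$, $e_a$ is the standard basis vector of $\mathbb{C}^{V}$ indexed by $a$, where $V$ is the vertex set. For distinct vertices $a,b$ of a graph with adjacency matrix $A$ and $U(t)=\exp(itA)$, there is perfect state transfer from $a$ to $b$ at time $\tau$ if $U(\tau)e_a=\gamma e_b$ for some complex number $\gamma$ (necessarily $|\gamma|=1$). *)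

theory Defs
  imports "Jordan_Normal_Form.Jordan_Normal_Form"
begin

(* The vertex set is {..<k + l + 2}: 0 and 1 are the centers, 2..k+1 the leaves attached to 0,
   and k+2..k+l+1 the leaves attached to 1. *)

definition double_star_edges :: "nat \<Rightarrow> nat \<Rightarrow> nat set set" where
  "double_star_edges k l =
     {{0, 1}} \<union> {{0, j} | j. 2 \<le> j \<and> j < k + 2} \<union> {{1, j} | j. k + 2 \<le> j \<and> j < k + l + 2}"

lemma double_star_simple_graph:
  assumes "e \<in> double_star_edges k l"
  shows "e \<subseteq> {..<k + l + 2}" "card e = 2"
  using assms by (auto simp: double_star_edges_def)

lemma double_star_neighbours:
  "{v. {0, v} \<in> double_star_edges k l} = {1} \<union> {2..<k + 2}"
  "{v. {1, v} \<in> double_star_edges k l} = {0} \<union> {k + 2..<k + l + 2}"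
  "2 \<le> j \<Longrightarrow> j < k + 2 \<Longrightarrow> {v. {j, v} \<in> double_star_edges k l} = {0}"
  "k + 2 \<le> j \<Longrightarrow> j < k + l + 2 \<Longrightarrow> {v. {j, v} \<in> double_star_edges k l} = {1}"
  by (auto simp: double_star_edges_def doubleton_eq_iff)

(* Not called adj_mat: in the library that is the adjugate of a matrix. *)
definition adjacency_mat :: "nat \<Rightarrow> nat set set \<Rightarrow> complex mat" where
  "adjacency_mat n E = mat n n (\<lambda>(u, v). if {u, v} \<in> E then 1 else 0)"

(* The entrywise sum of the power series M^m / m!; it converges for every square matrix,
   see mat_exp_sums. *)
definition mat_exp :: "complex mat \<Rightarrow> complex mat" where
  "mat_exp M = mat (dim_row M) (dim_row M) (\<lambda>(i, j). \<Sum>m. (M ^\<^sub>m m) $$ (i, j) / fact m)"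

lemma mat_exp_sums:
  assumes M: "M \<in> carrier_mat n n" and i: "i < n" and j: "j < n"
  shows "(\<lambda>m. (M ^\<^sub>m m) $$ (i, j) / fact m) sums (mat_exp M $$ (i, j))"
proof -
  obtain b where b: "norm_bound M b"
    using norm_bound_max by blast
  have pow: "norm_bound (M ^\<^sub>m m) ((b * real n) ^ m)" for m
  proof (induction m)
    case 0
    then show ?case by (auto simp: norm_bound_def)
  next
    case (Suc m)
    have "norm_bound (M ^\<^sub>m m * M) ((b * real n) ^ m * b * of_nat n)"
      by (rule norm_bound_mult[OF pow_carrier_mat[OF M] M Suc.IH b])
    then show ?case by (simp add: mult_ac)
  qed
  have "norm ((M ^\<^sub>m m) $$ (i, j) / fact m) \<le> inverse (fact m) * (b * real n) ^ m" for m
  proof -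
    have "norm ((M ^\<^sub>m m) $$ (i, j)) \<le> (b * real n) ^ m"
      using pow[of m] pow_carrier_mat[OF M, of m] M i j by (auto simp: norm_bound_def)
    then show ?thesis by (simp add: norm_divide field_simps)
  qed
  then have "summable (\<lambda>m. (M ^\<^sub>m m) $$ (i, j) / fact m)"
    by (intro summable_comparison_test[OF _ summable_exp[of "b * real n"]]) auto
  then show ?thesis
    using M i j by (auto simp: mat_exp_def summable_sums)
qed

definition transition_mat :: "complex mat \<Rightarrow> real \<Rightarrow> complex mat" where
  "transition_mat A t = mat_exp ((\<i> * complex_of_real t) \<cdot>\<^sub>m A)"

(* In the graph with vertex set {..<n} and edge set E. *)
definition perfect_state_transfer :: "nat \<Rightarrow> nat set set \<Rightarrow> nat \<Rightarrow> nat \<Rightarrow> real \<Rightarrow> bool" where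
  "perfect_state_transfer n E a b \<tau> \<longleftrightarrow>
     a < n \<and> b < n \<and> a \<noteq> b \<and>
     (\<exists>\<gamma>::complex. transition_mat (adjacency_mat n E) \<tau> *\<^sub>v unit_vec n a = \<gamma> \<cdot>\<^sub>v unit_vec n b)"

end

theory Submission
  imports Defs
begin

text \<open>
  If $U(\tau) e_a = \gamma e_b$ and $v$ is a real eigenvector of $A$ for $\theta$, then
  $e^{i\tau\theta} v_a = \gamma v_b$. For two leaves $c, d$ at the same center, $e_c - e_d$ is an
  eigenvector for 0; hence a leaf can only be a transfer endpoint if it has no twins, or if the
  transfer goes to its only twin, with $\gamma = -1$. The remaining eigenvalues are the four roots
  $\pm x, \pm y$ of $(t^2 - k)(t^2 - l) = t^2$, which satisfy $x^2 + y^2 = k + l + 1$ and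
  $x^2 y^2 = kl$. Comparing moduli of $v_a$ and $\gamma v_b$ for these leaves only the twin leaves,
  and, for $k = l$, the two centers or the ends of the path $P_4$. In these cases
  $e^{isx} = e^{isy} = -1$ with $s = \tau$ or $s = 2\tau$, so $x / y$ is a ratio $p / q$ of odd
  integers and $(k + l + 1)^2 p^2 q^2 = kl (p^2 + q^2)^2$, which is impossible modulo powers of 2.
\<close>

section \<open>Eigenvectors and the matrix exponential\<close>

definition double_star_eigenvector :: "nat \<Rightarrow> nat \<Rightarrow> real \<Rightarrow> (nat \<Rightarrow> real) \<Rightarrow> bool" where
  "double_star_eigenvector k l \<theta> v \<longleftrightarrow>
     (\<forall>j < k + l + 2. (\<Sum>i | i < k + l + 2 \<and> {j, i} \<in> double_star_edges k l. v i) = \<theta> * v j)"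

text \<open>Induction on the power gives eigenvalue \<open>\<theta> ^ m\<close> for
  \<open>M ^\<^sub>m m\<close>, and the exponential series is then summed termwise. Left
  eigenvectors are used because \<open>v\<close> will be paired with column \<open>a\<close> of the
  transition matrix.\<close>

lemma mat_exp_left_eigenvector:
  fixes v :: "nat \<Rightarrow> complex"
  assumes M: "M \<in> carrier_mat n n"
    and eig: "\<And>j. j < n \<Longrightarrow> (\<Sum>i<n. v i * M $$ (i, j)) = \<theta> * v j"
    and j: "j < n"
  shows "(\<Sum>i<n. v i * mat_exp M $$ (i, j)) = exp \<theta> * v j"
proof -
  have pow: "(\<Sum>i<n. v i * (M ^\<^sub>m m) $$ (i, j)) = \<theta> ^ m * v j" if "j < n" for m j
    using that
  proof (induction m arbitrary: j)
    case 0
    then show ?case using M by (simp add: if_distrib cong: if_cong)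
  next
    case (Suc m)
    have "(\<Sum>i<n. v i * (M ^\<^sub>m Suc m) $$ (i, j))
        = (\<Sum>i<n. \<Sum>h<n. v i * (M ^\<^sub>m m) $$ (i, h) * M $$ (h, j))"
      using M pow_carrier_mat[OF M, of m] Suc.prems
      by (intro sum.cong)
         (auto simp: scalar_prod_def sum_distrib_left mult.assoc atLeast0LessThan)
    also have "\<dots> = (\<Sum>h<n. (\<Sum>i<n. v i * (M ^\<^sub>m m) $$ (i, h)) * M $$ (h, j))"
      by (subst sum.swap) (simp add: sum_distrib_right)
    also have "\<dots> = \<theta> ^ m * (\<Sum>h<n. v h * M $$ (h, j))"
      by (simp add: Suc.IH sum_distrib_left mult.assoc)
    also have "\<dots> = \<theta> ^ Suc m * v j"
      by (simp add: eig Suc.prems)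
    finally show ?case .
  qed
  have "(\<lambda>m. \<Sum>i<n. v i * ((M ^\<^sub>m m) $$ (i, j) / fact m)) sums (\<Sum>i<n. v i * mat_exp M $$ (i, j))"
    by (intro sums_sum sums_mult mat_exp_sums[OF M _ j]) auto
  moreover have "(\<Sum>i<n. v i * ((M ^\<^sub>m m) $$ (i, j) / fact m)) = \<theta> ^ m /\<^sub>R fact m * v j" for m
    using pow[OF j, of m] by (simp add: sum_divide_distrib[symmetric] scaleR_conv_of_real field_simps)
  ultimately have "(\<lambda>m. \<theta> ^ m /\<^sub>R fact m * v j) sums (\<Sum>i<n. v i * mat_exp M $$ (i, j))"
    by simp
  moreover have "(\<lambda>m. \<theta> ^ m /\<^sub>R fact m * v j) sums (exp \<theta> * v j)"
    by (intro sums_mult2 exp_converges)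
  ultimately show ?thesis
    by (rule sums_unique2)
qed

text \<open>Both sides of the transfer equation are paired with \<open>v\<close>. The phase \<gamma>
  is fixed before \<theta> and \<open>v\<close>, so relations from different eigenvalues can be
  compared.\<close>

lemma perfect_state_transfer_eigenvectors:
  assumes "perfect_state_transfer n E a b \<tau>"
  obtains \<gamma> :: complex where
    "\<forall>(\<theta>::real) v. (\<forall>j < n. (\<Sum>i | i < n \<and> {j, i} \<in> E. v i) = \<theta> * v j) \<longrightarrow>
       cis (\<tau> * \<theta>) * of_real (v a) = \<gamma> * of_real (v b)"
proof -
  let ?A = "adjacency_mat n E"
  let ?M = "(\<i> * complex_of_real \<tau>) \<cdot>\<^sub>m ?A"
  from assms obtain \<gamma> where a: "a < n" and b: "b < n"
    and eq: "transition_mat ?A \<tau> *\<^sub>v unit_vec n a = \<gamma> \<cdot>\<^sub>v unit_vec n b"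
    unfolding perfect_state_transfer_def by blast
  have A: "?A \<in> carrier_mat n n" by (simp add: adjacency_mat_def)
  then have M: "?M \<in> carrier_mat n n" by simp
  have U: "mat_exp ?M \<in> carrier_mat n n"
    using M A by (simp add: mat_exp_def)
  have col: "mat_exp ?M $$ (i, a) = \<gamma> * (if i = b then 1 else 0)" if "i < n" for i
  proof -
    have "mat_exp ?M $$ (i, a) = (mat_exp ?M *\<^sub>v unit_vec n a) $ i"
      using U that a by (simp add: scalar_prod_right_unit[of _ n])
    also have "\<dots> = (\<gamma> \<cdot>\<^sub>v unit_vec n b) $ i"
      using eq by (simp add: transition_mat_def)
    finally show ?thesis using that b by simp
  qed
  show thesis
  proof (rule that, intro allI impI)
    fix \<theta> :: real and v :: "nat \<Rightarrow> real"
    assume v: "\<forall>j < n. (\<Sum>i | i < n \<and> {j, i} \<in> E. v i) = \<theta> * v j"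
    have "(\<Sum>i<n. of_real (v i) * ?M $$ (i, j)) = (\<i> * of_real (\<tau> * \<theta>)) * of_real (v j)"
      if "j < n" for j
    proof -
      have "(\<Sum>i<n. of_real (v i) * ?M $$ (i, j))
          = (\<Sum>i<n. if {j, i} \<in> E then \<i> * of_real \<tau> * of_real (v i) else 0)"
        \<comment> \<open>Symmetry of the adjacency matrix turns the neighbour sum into a left
          eigenvector equation.\<close>
        using that A by (intro sum.cong) (auto simp: adjacency_mat_def insert_commute)
      also have "\<dots> = \<i> * of_real \<tau> * of_real (\<Sum>i | i < n \<and> {j, i} \<in> E. v i)"
        by (simp add: sum.If_cases sum_distrib_left Int_def lessThan_def)
      finally show ?thesis using v that by (simp add: mult_ac)
    qed
    from mat_exp_left_eigenvector[OF M this a]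
    have "(\<Sum>i<n. of_real (v i) * mat_exp ?M $$ (i, a)) = cis (\<tau> * \<theta>) * of_real (v a)"
      by (simp add: cis_conv_exp)
    moreover have "(\<Sum>i<n. of_real (v i) * mat_exp ?M $$ (i, a)) = \<gamma> * of_real (v b)"
      using b by (simp add: col if_distrib sum.delta mult_ac cong: if_cong)
    ultimately show "cis (\<tau> * \<theta>) * of_real (v a) = \<gamma> * of_real (v b)" by simp
  qed
qed

section \<open>Spectrum of the double star\<close>

lemma double_star_eigenvectorI:
  fixes v :: "nat \<Rightarrow> real"
  assumes "v 1 + (\<Sum>i\<in>{2..<k + 2}. v i) = \<theta> * v 0"
    and "v 0 + (\<Sum>i\<in>{k + 2..<k + l + 2}. v i) = \<theta> * v 1"
    and "\<And>j. j \<in> {2..<k + 2} \<Longrightarrow> v 0 = \<theta> * v j"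
    and "\<And>j. j \<in> {k + 2..<k + l + 2} \<Longrightarrow> v 1 = \<theta> * v j"
  shows "double_star_eigenvector k l \<theta> v"
  unfolding double_star_eigenvector_def
proof (intro allI impI)
  fix j assume j: "j < k + l + 2"
  have *: "{i. i < k + l + 2 \<and> {j, i} \<in> double_star_edges k l}
         = {i. {j, i} \<in> double_star_edges k l}" for j
    using double_star_simple_graph(1) by blast
  consider "j = 0" | "j = 1" | "j \<in> {2..<k + 2}" | "j \<in> {k + 2..<k + l + 2}"
    using j by fastforce
  then show "(\<Sum>i | i < k + l + 2 \<and> {j, i} \<in> double_star_edges k l. v i) = \<theta> * v j"
    unfolding * using assms double_star_neighbours
    by cases (auto simp: numeral_2_eq_2)
qed

text \<open>Setting the value at centre 0 to t^2 forces all other values through the equations at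
  its leaves, at centre 0 and at the far leaves; the equation left over at centre 1 is the
  assumption. The second vector starts from centre 1 instead. For nonzero t the two are
  proportional, but each gives the leaves of its own centre the value t.\<close>

lemma double_star_eigenvector_root:
  fixes t :: real
  assumes "(t\<^sup>2 - k) * (t\<^sup>2 - l) = t\<^sup>2"
  shows "double_star_eigenvector k l t
    (\<lambda>j. if j = 0 then t\<^sup>2 else if j = 1 then t * (t\<^sup>2 - k) else if j < k + 2 then t else t\<^sup>2 - k)"
    (is ?v)
    and "double_star_eigenvector k l t
    (\<lambda>j. if j = 0 then t * (t\<^sup>2 - l) else if j = 1 then t\<^sup>2 else if j < k + 2 then t\<^sup>2 - l else t)"
    (is ?w)
proof -
  show ?v
    using assms by (intro double_star_eigenvectorI) (auto simp: power2_eq_square algebra_simps)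
  show ?w
    using assms by (intro double_star_eigenvectorI) (auto simp: power2_eq_square algebra_simps)
qed

lemma double_star_eigenvector_leaves:
  assumes "c \<noteq> d"
    and "{c, d} \<subseteq> {2..<k + 2} \<or> {c, d} \<subseteq> {k + 2..<k + l + 2}"
  shows "double_star_eigenvector k l 0 (\<lambda>j. of_bool (j = c) - of_bool (j = d))"
  using assms
  by (intro double_star_eigenvectorI) (auto simp: sum_subtractf of_bool_def)

lemma double_star_eigenvalues:
  fixes k l :: nat
  assumes "k \<ge> 1" "l \<ge> 1"
  obtains x y :: real where
    "x \<noteq> 0" "y \<noteq> 0" "x\<^sup>2 \<noteq> y\<^sup>2"
    "x\<^sup>2 + y\<^sup>2 = k + l + 1" "x\<^sup>2 * y\<^sup>2 = k * l"
    "(x\<^sup>2 - k) * (x\<^sup>2 - l) = x\<^sup>2" "(y\<^sup>2 - k) * (y\<^sup>2 - l) = y\<^sup>2"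
proof -
  define S D where "S = real k + l + 1" and "D = sqrt (S\<^sup>2 - 4 * k * l)"
  have disc: "S\<^sup>2 - 4 * k * l = (real k - l)\<^sup>2 + 2 * (real k + l) + 1"
    by (simp add: S_def power2_eq_square algebra_simps)
  then have D: "D\<^sup>2 = S\<^sup>2 - 4 * k * l" "D > 0"
    unfolding D_def by (simp_all add: add_nonneg_pos)
  \<comment> \<open>Since kl > 0; this makes y^2 positive.\<close>
  have "D < S"
    using assms D(1) by (intro power2_less_imp_less[of D S]) (auto simp: S_def)
  define x y where "x = sqrt ((S + D) / 2)" and "y = sqrt ((S - D) / 2)"
  have xy: "x\<^sup>2 = (S + D) / 2" "y\<^sup>2 = (S - D) / 2" "x > 0" "y > 0"
    unfolding x_def y_def using \<open>D < S\<close> \<open>D > 0\<close> by auto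
  have prod: "x\<^sup>2 * y\<^sup>2 = k * l"
    unfolding xy using D(1) by (simp add: field_simps power2_eq_square)
  have sum: "x\<^sup>2 + y\<^sup>2 = k + l + 1"
    unfolding xy by (simp add: S_def field_simps)
  show thesis
  proof (rule that[of x y])
    show "x\<^sup>2 \<noteq> y\<^sup>2" unfolding xy using D(2) by simp
    \<comment> \<open>Vieta: t and u are the roots of z^2 - (k + l + 1) z + kl, which is (z - k)(z -
      l) - z.\<close>
    have *: "(t - k) * (t - l) = t" if "t + u = k + l + 1" "t * u = k * l" for t u :: real
    proof -
      have "u = k + l + 1 - t" using that by simp
      then have "t * (k + l + 1 - t) = k * l" using that(2) by simp
      then show ?thesis by (simp add: algebra_simps)
    qed
    show "(x\<^sup>2 - k) * (x\<^sup>2 - l) = x\<^sup>2" by (rule * [OF sum prod])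
    show "(y\<^sup>2 - k) * (y\<^sup>2 - l) = y\<^sup>2"
      using * [of "y\<^sup>2" "x\<^sup>2"] sum prod by (simp add: add.commute mult.commute)
  qed (use xy sum prod in auto)
qed

section \<open>Parity obstruction to odd eigenvalue ratios\<close>

lemma odd_squares_ratio:
  fixes p q :: int and k l :: nat
  assumes "odd p" "odd q" and kl: "even (k + l) \<or> \<not> 4 dvd k * l"
  shows "(k + l + 1)\<^sup>2 * (p\<^sup>2 * q\<^sup>2) \<noteq> k * l * (p\<^sup>2 + q\<^sup>2)\<^sup>2"
proof
  assume eq: "(k + l + 1)\<^sup>2 * (p\<^sup>2 * q\<^sup>2) = k * l * (p\<^sup>2 + q\<^sup>2)\<^sup>2"
  obtain w where w: "p\<^sup>2 + q\<^sup>2 = 2 * w" using assms by (elim evenE[rotated]) auto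
  from eq have "even ((k + l + 1)\<^sup>2 * (p\<^sup>2 * q\<^sup>2))" unfolding w by simp
  \<comment> \<open>If k + l were even, the left side would be odd. What remains is to show that 4
    divides kl, contradicting \<open>kl\<close>.\<close>
  then have odd: "odd (k + l)" using assms by auto
  then obtain s where s: "k + l + 1 = 2 * s" by (metis evenE even_plus_one_iff)
  have "4 * ((int s)\<^sup>2 * (p\<^sup>2 * q\<^sup>2)) = 4 * (int (k * l) * w\<^sup>2)"
    using eq unfolding w s by (simp add: power_mult_distrib)
  then have eq': "(int s)\<^sup>2 * (p\<^sup>2 * q\<^sup>2) = int (k * l) * w\<^sup>2" by simp
  have "even (k * l)" using odd by auto
  then have "even ((int s)\<^sup>2 * (p\<^sup>2 * q\<^sup>2))" unfolding eq' by simp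
  then have "even s" using assms by auto
  then have "4 dvd (int s)\<^sup>2 * (p\<^sup>2 * q\<^sup>2)" by (auto elim!: evenE simp: power2_eq_square)
  then have d: "4 dvd int (k * l) * w\<^sup>2" by (simp add: eq')
  \<comment> \<open>A sum of two odd squares is 2 modulo 4.\<close>
  have "odd w"
  proof
    assume "even w"
    then have "4 dvd p\<^sup>2 + q\<^sup>2" unfolding w by auto
    moreover obtain i j where "p = 2 * i + 1" "q = 2 * j + 1" using assms by (elim oddE)
    then have "p\<^sup>2 + q\<^sup>2 = 4 * (i\<^sup>2 + i + j\<^sup>2 + j) + 2" by (simp add: power2_eq_square algebra_simps)
    ultimately show False by presburger
  qed
  then have "coprime (2 ^ 2) (w\<^sup>2)" by (intro coprime_power_left_iff[THEN iffD2]) auto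
  then have "4 dvd int (k * l)" using d coprime_dvd_mult_left_iff by fastforce
  then have "4 dvd k * l" by presburger
  then show False using kl odd by auto
qed

lemma cis_eq_minus_one:
  assumes "cis x = -1"
  obtains p :: int where "odd p" "x = p * pi"
proof -
  have "cis (x - pi) = 1" using assms by (simp add: cis_divide[symmetric])
  then have "cos (x - pi) = 1" by (simp add: complex_eq_iff)
  then obtain n :: int where "x - pi = of_int n * 2 * pi" unfolding cos_one_2pi_int by blast
  then have "x = of_int (2 * n + 1) * pi" by (simp add: algebra_simps)
  then show thesis by (intro that[of "2 * n + 1"]) auto
qed

text \<open>The quotient of (x^2 + y^2)^2 by x^2 y^2 is invariant under scaling, so x and y may be
  replaced by the odd integers p and q, and \<open>odd_squares_ratio\<close> applies.\<close>

lemma not_both_cis_minus_one: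
  fixes x y s :: real and k l :: nat
  assumes "x\<^sup>2 + y\<^sup>2 = k + l + 1" "x\<^sup>2 * y\<^sup>2 = k * l"
    and "even (k + l) \<or> \<not> 4 dvd k * l"
    and "cis (s * x) = -1" "cis (s * y) = -1"
  shows False
proof -
  obtain p q :: int where pq: "odd p" "odd q" "s * x = p * pi" "s * y = q * pi"
    using assms(4,5) by (metis cis_eq_minus_one)
  have "((k + l + 1)\<^sup>2 * (p\<^sup>2 * q\<^sup>2)) * pi ^ 4 = (x\<^sup>2 + y\<^sup>2)\<^sup>2 * ((p * pi)\<^sup>2 * (q * pi)\<^sup>2)"
    using assms(1) by (simp add: algebra_simps power_mult_distrib power4_eq_xxxx power2_eq_square)
  also have "\<dots> = (x\<^sup>2 * y\<^sup>2) * ((s * x)\<^sup>2 + (s * y)\<^sup>2)\<^sup>2"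
    unfolding pq(3,4)[symmetric]
    by (simp add: algebra_simps power_mult_distrib power2_eq_square)
  also have "\<dots> = (k * l * (p\<^sup>2 + q\<^sup>2)\<^sup>2) * pi ^ 4"
    unfolding pq(3,4) assms(2) by (simp add: algebra_simps power4_eq_xxxx power2_eq_square)
  finally have "of_int ((k + l + 1)\<^sup>2 * (p\<^sup>2 * q\<^sup>2)) = (of_int (k * l * (p\<^sup>2 + q\<^sup>2)\<^sup>2) :: real)"
    by simp
  then show False
    using odd_squares_ratio[OF pq(1,2) assms(3)] by (simp only: of_int_eq_iff)
qed

section \<open>Excluding each kind of transfer\<close>

lemma leaf_to_own_centre:
  fixes k l :: nat
  assumes "k \<ge> 1" "l \<ge> 1"
    and phase: "\<And>t::real. (t\<^sup>2 - k) * (t\<^sup>2 - l) = t\<^sup>2 \<Longrightarrow> cis (\<tau> * t) * t = \<gamma> * of_real (t\<^sup>2)"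
  shows False
proof -
  from assms(1,2) obtain x y :: real where xy: "x \<noteq> 0" "y \<noteq> 0" "x\<^sup>2 \<noteq> y\<^sup>2"
    and ev: "(x\<^sup>2 - k) * (x\<^sup>2 - l) = x\<^sup>2" "(y\<^sup>2 - k) * (y\<^sup>2 - l) = y\<^sup>2"
    by (rule double_star_eigenvalues)
  \<comment> \<open>The modulus of \<gamma> determines that of t, but the roots x and y have
    different moduli.\<close>
  have "cmod \<gamma> * \<bar>t\<bar> = 1" if "(t\<^sup>2 - k) * (t\<^sup>2 - l) = t\<^sup>2" "t \<noteq> 0" for t :: real
  proof -
    have "\<bar>t\<bar> * (cmod \<gamma> * \<bar>t\<bar>) = \<bar>t\<bar> * 1"
      using arg_cong[OF phase[OF that(1)], of cmod]
      by (simp only: norm_mult norm_cis norm_of_real power2_eq_square abs_mult mult_ac)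
    then show ?thesis using that(2) by (simp only: mult_cancel_left) simp
  qed
  from this[OF ev(1) xy(1)] this[OF ev(2) xy(2)] have "\<bar>x\<bar> = \<bar>y\<bar>"
    by (metis mult_cancel_left mult_zero_left zero_neq_one)
  then show False using xy(3) by (metis power2_abs)
qed

lemma single_leaf_to_other_centre:
  fixes k l :: nat
  assumes "k = 1" "l \<ge> 1"
    and phase: "\<And>t::real. (t\<^sup>2 - k) * (t\<^sup>2 - l) = t\<^sup>2 \<Longrightarrow> cis (\<tau> * t) * t = \<gamma> * of_real (t * (t\<^sup>2 - k))"
  shows False
proof -
  from assms(1,2) obtain x y :: real where xy: "x \<noteq> 0" "y \<noteq> 0" "x\<^sup>2 \<noteq> y\<^sup>2" "x\<^sup>2 + y\<^sup>2 = k + l + 1"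
    and ev: "(x\<^sup>2 - k) * (x\<^sup>2 - l) = x\<^sup>2" "(y\<^sup>2 - k) * (y\<^sup>2 - l) = y\<^sup>2"
    by (metis double_star_eigenvalues order_refl)
  have "cmod \<gamma> * \<bar>t\<^sup>2 - k\<bar> = 1" if "(t\<^sup>2 - k) * (t\<^sup>2 - l) = t\<^sup>2" "t \<noteq> 0" for t :: real
  proof -
    have "\<bar>t\<bar> * (cmod \<gamma> * \<bar>t\<^sup>2 - k\<bar>) = \<bar>t\<bar> * 1"
      using arg_cong[OF phase[OF that(1)], of cmod]
      by (simp only: norm_mult norm_cis norm_of_real abs_mult mult_ac)
    then show ?thesis using that(2) by (simp only: mult_cancel_left) simp
  qed
  from this[OF ev(1) xy(1)] this[OF ev(2) xy(2)] have "\<bar>x\<^sup>2 - k\<bar> = \<bar>y\<^sup>2 - k\<bar>"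
    by (metis mult_cancel_left mult_zero_left zero_neq_one)
  \<comment> \<open>As x^2 and y^2 differ, their sum must be 2k = 2, whereas it equals l +
    2.\<close>
  then show False using xy(3,4) assms(1,2) by (auto simp: abs_eq_iff)
qed

text \<open>The relation \<open>phase\<close> also describes transfer between leaves at different
  centres, whose eigenvector values are t and t^2 - k; those of the centres are t times
  these.\<close>

lemma centre_to_centre:
  fixes k l :: nat
  assumes "k \<ge> 1" "l \<ge> 1"
    and phase: "\<And>t::real. (t\<^sup>2 - k) * (t\<^sup>2 - l) = t\<^sup>2 \<Longrightarrow> cis (\<tau> * t) * of_real t = \<gamma> * of_real (t\<^sup>2 - k)"
  shows False
proof -
  from assms(1,2) obtain x y :: real where xy: "x \<noteq> 0" "y \<noteq> 0" "x\<^sup>2 \<noteq> y\<^sup>2"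
      "x\<^sup>2 + y\<^sup>2 = k + l + 1" "x\<^sup>2 * y\<^sup>2 = k * l"
    and ev: "(x\<^sup>2 - k) * (x\<^sup>2 - l) = x\<^sup>2" "(y\<^sup>2 - k) * (y\<^sup>2 - l) = y\<^sup>2"
    by (rule double_star_eigenvalues)
  \<comment> \<open>Squaring the moduli and multiplying by t^2 - l gives a relation linear in t^2.
    Holding at two distinct values of t^2, it forces equal slopes and then k = l.\<close>
  have lin: "t\<^sup>2 - l = (cmod \<gamma>)\<^sup>2 * (t\<^sup>2 - k)"
    if t: "(t\<^sup>2 - k) * (t\<^sup>2 - l) = t\<^sup>2" "t \<noteq> 0" for t :: real
  proof -
    have "\<bar>t\<bar> = cmod \<gamma> * \<bar>t\<^sup>2 - k\<bar>"
      using arg_cong[OF phase[OF t(1)], of cmod] by (simp only: norm_mult norm_cis norm_of_real mult_1)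
    then have "t\<^sup>2 = (cmod \<gamma>)\<^sup>2 * (t\<^sup>2 - k)\<^sup>2"
      by (metis power2_abs power_mult_distrib)
    then have "t\<^sup>2 * (t\<^sup>2 - l) = (cmod \<gamma>)\<^sup>2 * (t\<^sup>2 - k) * ((t\<^sup>2 - k) * (t\<^sup>2 - l))"
      by (simp add: power2_eq_square mult_ac)
    then show ?thesis unfolding t(1) using t(2) by (simp add: mult_ac)
  qed
  have "(x\<^sup>2 - y\<^sup>2) * ((cmod \<gamma>)\<^sup>2 - 1) = 0"
    using lin[OF ev(1) xy(1)] lin[OF ev(2) xy(2)] by (simp add: algebra_simps)
  then have "(cmod \<gamma>)\<^sup>2 = 1" using xy(3) by simp
  then have "k = l" using lin[OF ev(1) xy(1)] by simp
  \<comment> \<open>The eigenvalues \<open>t\<close> and \<open>- t\<close> give opposite phases.\<close>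
  have "cis (2 * \<tau> * t) = -1"
    if t: "(t\<^sup>2 - k) * (t\<^sup>2 - l) = t\<^sup>2" "t \<noteq> 0" for t :: real
  proof -
    have "cis (\<tau> * t) * of_real t = cis (- (\<tau> * t)) * - of_real t"
      using phase[of t] phase[of "- t"] t(1) by simp
    then have "cis (\<tau> * t) = - cis (- (\<tau> * t))" using t(2)
      by (metis minus_mult_commute mult_cancel_right of_real_eq_0_iff)
    then have "cis (\<tau> * t) * cis (\<tau> * t) = - (cis (- (\<tau> * t)) * cis (\<tau> * t))" by simp
    then show ?thesis by (simp add: cis_mult algebra_simps)
  qed
  from this[OF ev(1) xy(1)] this[OF ev(2) xy(2)] \<open>k = l\<close> show False
    using not_both_cis_minus_one[OF xy(4,5)] by auto
qed

lemma leaf_to_twin_leaf: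
  fixes k l :: nat
  assumes "k \<ge> 1" "l \<ge> 1" "k = 2 \<or> l = 2"
    and phase: "\<And>t::real. (t\<^sup>2 - k) * (t\<^sup>2 - l) = t\<^sup>2 \<Longrightarrow> cis (\<tau> * t) * of_real t = - of_real t"
  shows False
proof -
  from assms(1,2) obtain x y :: real where xy: "x \<noteq> 0" "y \<noteq> 0"
      "x\<^sup>2 + y\<^sup>2 = k + l + 1" "x\<^sup>2 * y\<^sup>2 = k * l"
    and ev: "(x\<^sup>2 - k) * (x\<^sup>2 - l) = x\<^sup>2" "(y\<^sup>2 - k) * (y\<^sup>2 - l) = y\<^sup>2"
    by (rule double_star_eigenvalues)
  \<comment> \<open>If one parameter is 2 and the other is odd, then kl is 2 modulo 4.\<close>
  have "even (k + l) \<or> \<not> 4 dvd k * l" using assms(3) by (elim disjE) (simp; presburger)+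
  moreover have "cis (\<tau> * t) = -1" if "(t\<^sup>2 - k) * (t\<^sup>2 - l) = t\<^sup>2" "t \<noteq> 0" for t :: real
  proof -
    have "cis (\<tau> * t) * of_real t = - 1 * of_real t" using phase[OF that(1)] by simp
    then show ?thesis using that(2) by (simp only: mult_cancel_right of_real_eq_0_iff) simp
  qed
  ultimately show False
    using not_both_cis_minus_one[OF xy(3,4)] ev xy by blast
qed

section \<open>Case analysis on the endpoints\<close>

text \<open>Only the phase relation is assumed, not a transfer, so that the lemma also serves the
  reversed direction. Twin leaves bound the number of leaves at the centre of \<open>a\<close>: one
  if \<open>b\<close> is not among them, two if it is.\<close>

lemma no_transfer_from_leaf:
  assumes kl: "k \<ge> 1" "l \<ge> 1" and a: "2 \<le> a" "a < k + l + 2" and b: "b < k + l + 2" "a \<noteq> b"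
    and phase: "\<And>\<theta> v. double_star_eigenvector k l \<theta> v \<Longrightarrow>
      cis (\<tau> * \<theta>) * of_real (v a) = \<gamma> * of_real (v b)"
  shows False
proof -
  \<comment> \<open>Otherwise the eigenvector for 0 supported on \<open>a\<close> and
    \<open>c\<close> has value 1 at \<open>a\<close> and 0 at \<open>b\<close>.\<close>
  have sibling: "c = b" if "c \<noteq> a" "{a, c} \<subseteq> {2..<k + 2} \<or> {a, c} \<subseteq> {k + 2..<k + l + 2}" for c
    using phase[OF double_star_eigenvector_leaves[of a c k l]] that b(2)
    by (cases "c = b") auto
  have twin: "\<gamma> = -1" if "{a, b} \<subseteq> {2..<k + 2} \<or> {a, b} \<subseteq> {k + 2..<k + l + 2}"
    using phase[OF double_star_eigenvector_leaves[of a b k l]] that b(2) by (simp add: minus_equation_iff)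
  have own1: "{2..<k + 2} \<subseteq> {a, b}" if "a < k + 2"
    using sibling a that by fastforce
  have own2: "{k + 2..<k + l + 2} \<subseteq> {a, b}" if "k + 2 \<le> a"
    using sibling a that by fastforce
  have k1: "k = 1" if "a < k + 2" "b \<notin> {2..<k + 2}"
  proof -
    have "{2..<k + 2} = {a}" using own1 that a by auto
    then have "card {2..<k + 2} = 1" by simp
    then show ?thesis by simp
  qed
  have l1: "l = 1" if "k + 2 \<le> a" "b \<notin> {k + 2..<k + l + 2}"
  proof -
    have "{k + 2..<k + l + 2} = {a}" using own2 that a by auto
    then have "card {k + 2..<k + l + 2} = 1" by simp
    then show ?thesis by simp
  qed
  have k2: "k = 2" if "a < k + 2" "b \<in> {2..<k + 2}"
  proof -
    have "{2..<k + 2} = {a, b}" using own1 that a by auto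
    then have "card {2..<k + 2} = 2" using b by simp
    then show ?thesis by simp
  qed
  have l2: "l = 2" if "k + 2 \<le> a" "b \<in> {k + 2..<k + l + 2}"
  proof -
    have "{k + 2..<k + l + 2} = {a, b}" using own2 that a by auto
    then have "card {k + 2..<k + l + 2} = 2" using b by simp
    then show ?thesis by simp
  qed
  \<comment> \<open>The first vector is used when \<open>a\<close> hangs on centre 0, the second
    when it hangs on centre 1; either way its value at \<open>a\<close> is t.\<close>
  note root = phase[OF double_star_eigenvector_root(1)] phase[OF double_star_eigenvector_root(2)]
  consider "b = 0" | "b = 1" | "b \<in> {2..<k + 2}" | "b \<in> {k + 2..<k + l + 2}"
    using b by fastforce
  then show False
  proof cases
    case 1
    show False
    proof (cases "a < k + 2")
      case True
      then show False using root(1) a 1 kl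
        by (intro leaf_to_own_centre[of k l \<tau> \<gamma>]) auto
    next
      case False
      then show False using root(2) a 1 kl l1
        by (intro single_leaf_to_other_centre[of l k \<tau> \<gamma>]) (auto simp: mult.commute)
    qed
  next
    case 2
    show False
    proof (cases "a < k + 2")
      case True
      then show False using root(1) a 2 kl k1
        by (intro single_leaf_to_other_centre[of k l \<tau> \<gamma>]) auto
    next
      case False
      then show False using root(2) a 2 kl
        by (intro leaf_to_own_centre[of l k \<tau> \<gamma>]) (auto simp: mult.commute)
    qed
  next
    case 3
    show False
    proof (cases "a < k + 2")
      case True
      then have "k = 2" "\<gamma> = -1" using k2 twin 3 a by auto
      then show False using root(1) a b 3 kl True
        by (intro leaf_to_twin_leaf[of k l \<tau>]) auto
    next
      case False
      then show False using root(2) a b 3 kl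
        by (intro centre_to_centre[of l k \<tau> \<gamma>]) (auto simp: mult.commute)
    qed
  next
    case 4
    show False
    proof (cases "a < k + 2")
      case True
      then show False using root(1) a b 4 kl
        by (intro centre_to_centre[of k l \<tau> \<gamma>]) auto
    next
      case False
      then have "l = 2" "\<gamma> = -1" using l2 twin 4 a by auto
      then show False using root(2) a b 4 kl False
        by (intro leaf_to_twin_leaf[of k l \<tau>]) auto
    qed
  qed
qed

theorem theorem4p6:
  fixes k l :: nat
  assumes "k \<ge> 1" and "l \<ge> 1"
  shows "\<not> (\<exists>a b \<tau>. perfect_state_transfer (k + l + 2) (double_star_edges k l) a b \<tau>)"
proof (intro notI, elim exE)
  fix a b \<tau>
  assume pst: "perfect_state_transfer (k + l + 2) (double_star_edges k l) a b \<tau>"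
  then have ab: "a < k + l + 2" "b < k + l + 2" "a \<noteq> b"
    by (auto simp: perfect_state_transfer_def)
  obtain \<gamma> where "\<forall>\<theta> v. double_star_eigenvector k l \<theta> v \<longrightarrow>
      cis (\<tau> * \<theta>) * of_real (v a) = \<gamma> * of_real (v b)"
    unfolding double_star_eigenvector_def by (rule perfect_state_transfer_eigenvectors[OF pst])
  then have phase: "cis (\<tau> * \<theta>) * of_real (v a) = \<gamma> * of_real (v b)"
    if "double_star_eigenvector k l \<theta> v" for \<theta> v
    using that by blast
  note root = phase[OF double_star_eigenvector_root(1)] phase[OF double_star_eigenvector_root(2)]
  have nonzero: "t \<noteq> 0" if "(t\<^sup>2 - k) * (t\<^sup>2 - l) = t\<^sup>2" for t :: real
    using that assms by auto
  \<comment> \<open>For a root t, both t and t^2 - k are nonzero, so the first root eigenvector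
    vanishes at no vertex.\<close>
  have "\<gamma> \<noteq> 0"
  proof
    assume "\<gamma> = 0"
    from assms obtain t :: real where t: "(t\<^sup>2 - k) * (t\<^sup>2 - l) = t\<^sup>2"
      by (rule double_star_eigenvalues)
    then have "t\<^sup>2 \<noteq> k" using nonzero[OF t] by auto
    then show False using root(1)[OF t] nonzero[OF t] \<open>\<gamma> = 0\<close>
      by (auto split: if_splits simp flip: of_real_power)
  qed
  \<comment> \<open>Time reversal: transfer from \<open>b\<close> to \<open>a\<close> at time
    -\<tau> with phase 1/\<gamma>. This covers the case where \<open>b\<close> is a leaf.\<close>
  then have reverse: "cis (- \<tau> * \<theta>) * of_real (v b) = inverse \<gamma> * of_real (v a)"
    if "double_star_eigenvector k l \<theta> v" for \<theta> v
  proof -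
    have "of_real (v b) = inverse \<gamma> * (cis (\<tau> * \<theta>) * of_real (v a))"
      using phase[OF that] \<open>\<gamma> \<noteq> 0\<close> by simp
    then have "cis (- \<tau> * \<theta>) * of_real (v b) = inverse \<gamma> * (cis (- \<tau> * \<theta>) * cis (\<tau> * \<theta>)) * of_real (v a)"
      by (simp only: mult_ac)
    then show ?thesis by (simp add: cis_mult)
  qed
  consider "2 \<le> a" | "2 \<le> b" | "a = 0" "b = 1" | "a = 1" "b = 0"
    using ab by linarith
  then show False
  proof cases
    case 1
    show False by (rule no_transfer_from_leaf[OF assms 1 ab]) (rule phase)
  next
    case 2
    show False by (rule no_transfer_from_leaf[OF assms 2 ab(2,1) ab(3)[symmetric]]) (rule reverse)
  next
    case 3
    show False
    proof (rule centre_to_centre[OF assms])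
      fix t :: real
      assume t: "(t\<^sup>2 - k) * (t\<^sup>2 - l) = t\<^sup>2"
      \<comment> \<open>The centres have values t^2 and t (t^2 - k); cancelling t leaves the form
        required by \<open>centre_to_centre\<close>.\<close>
      have "of_real t * (cis (\<tau> * t) * of_real t) = of_real t * (\<gamma> * of_real (t\<^sup>2 - k))"
        using root(1)[OF t] 3 by (simp add: power2_eq_square mult_ac)
      then show "cis (\<tau> * t) * of_real t = \<gamma> * of_real (t\<^sup>2 - k)"
        using nonzero[OF t] by (simp only: mult_cancel_left of_real_eq_0_iff) simp
    qed
  next
    case 4
    show False
    proof (rule centre_to_centre[OF assms(2,1)])
      fix t :: real
      assume "(t\<^sup>2 - l) * (t\<^sup>2 - k) = t\<^sup>2"
      then have t: "(t\<^sup>2 - k) * (t\<^sup>2 - l) = t\<^sup>2" by (simp add: mult.commute)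
      have "of_real t * (cis (\<tau> * t) * of_real t) = of_real t * (\<gamma> * of_real (t\<^sup>2 - l))"
        using root(2)[OF t] 4 by (simp add: power2_eq_square mult_ac)
      then show "cis (\<tau> * t) * of_real t = \<gamma> * of_real (t\<^sup>2 - l)"
        using nonzero[OF t] by (simp only: mult_cancel_left of_real_eq_0_iff) simp
    qed
  qed
qed

end
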